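(* Let $\alpha$ be as in the context, let $k\ge2$, $0<l\le a_k$, and $n=q_{k,l}$. Then $C^i(\widetilde{s}_{k,l})\in\mathcal{L}(\alpha)$ for $0\le i\le n-1$. For $0\le i\le q_{k-1}-2$ (the first $q_{k-1}-1$ conjugates) the interval $[C^i(\widetilde{s}_{k,l})]$ has length $\|q_{k,l-1}\alpha\|$, and for $q_{k-1}-1\le i\le n-1$ (the remaining $n+1-q_{k-1}$ conjugates) the interval $[C^i(\widetilde{s}_{k,l})]$ has length $\|q_{k-1}\alpha\|$. The remaining factor of length $n$ in $\mathcal{L}(\alpha)$ (the one factor of length $n$ not of the form $C^i(\widetilde{s}_{k,l})$) has an interval of length $\|q_{k,l}\alpha\|$.
   Context: Let $\alpha\in(0,1)$ be irrational with $\alpha=[0;a_1,a_2,\ldots]$ ($a_i$ positive integers) and $a_1\ge2$. Define $q_0=1$, $q_1=a_1$, $q_k=a_kq_{k-1}+q_{k-2}$ ($k\ge2$), and $q_{k,l}=lq_{k-1}+q_{k-2}$ for $k\ge2$, $0\le l\le a_k$. $\|x\|$ is the distance from $x$ to the nearest integer. Standard words: $s_{-1}=1$, $s_0=0$, $s_1=0^{a_1-1}1$, $s_k=s_{k-1}^{a_k}s_{k-2}$ ($k\ge2$), and $s_{k,l}=s_{k-1}^ls_{k-2}$ for $k\ge2$, $0<l\le a_k$; $|s_{k,l}|=q_{k,l}$. For a word $w=b_1\cdots b_n$, $\widetilde{w}=b_n\cdots b_1$ is its reversal and $C(b_1\cdots b_{n-1}b_n)=b_nb_1\cdots b_{n-1}$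 is the cyclic shift. Let $R(x)=\{x+\alpha\}$ on $[0,1)$ (identified with the circle), $I_0=[0,1-\alpha)$, $I_1=[1-\alpha,1)$, and $s_{x,\alpha}$ the infinite word whose $n$-th letter ($n\ge0$) is $0$ if $R^n(x)\in I_0$ and $1$ otherwise. $\mathcal{L}(\alpha)$ is the set of finite factors of $s_{x,\alpha}$ (independent of $x$); it has exactly $n+1$ words of length $n$. For $w\in\mathcal{L}(\alpha)$, $[w]$ is the set of $x\in[0,1)$ such that $s_{x,\alpha}$ begins with $w$; it is an arc of the circle, and its length is denoted $|[w]|$. *)

theory Defs
  imports "HOL-Analysis.Analysis"
begin

text \<open>Partial quotients are given as \<open>a :: nat \<Rightarrow> nat\<close>; only the values \<open>a 1, a 2, \<dots>\<close> matter.\<close>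

text \<open>\<open>cf_finite [a\<^sub>1, \<dots>, a\<^sub>n]\<close> is the finite continued fraction \<open>[0; a\<^sub>1, \<dots>, a\<^sub>n]\<close>.\<close>

fun cf_finite :: "nat list \<Rightarrow> real" where
  "cf_finite [] = 0"
| "cf_finite (b # bs) = 1 / (real b + cf_finite bs)"

definition has_cf_expansion :: "real \<Rightarrow> (nat \<Rightarrow> nat) \<Rightarrow> bool" where
  "has_cf_expansion \<alpha> a \<longleftrightarrow>
     (\<forall>i\<ge>1. a i > 0) \<and> (\<lambda>n. cf_finite (map a [1..<Suc n])) \<longlonglongrightarrow> \<alpha>"

fun q :: "(nat \<Rightarrow> nat) \<Rightarrow> nat \<Rightarrow> nat" where
  "q a 0 = 1"
| "q a (Suc 0) = a 1"
| "q a (Suc (Suc k)) = a (Suc (Suc k)) * q a (Suc k) + q a k"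

text \<open>In \<open>q_inter\<close> and \<open>std_inter\<close> below, the index \<open>k\<close> is meant to satisfy \<open>k \<ge> 2\<close>.\<close>

definition q_inter :: "(nat \<Rightarrow> nat) \<Rightarrow> nat \<Rightarrow> nat \<Rightarrow> nat" where
  "q_inter a k l = l * q a (k - 1) + q a (k - 2)"

text \<open>Words are lists over the letters \<open>0\<close> and \<open>1\<close>.\<close>

definition word_pow :: "'a list \<Rightarrow> nat \<Rightarrow> 'a list" where
  "word_pow w m = concat (replicate m w)"

text \<open>The word \<open>s\<^sub>k\<close> for \<open>k \<ge> 0\<close>. The convention that the word of index \<open>-1\<close> is \<open>1\<close> is not
  needed, because \<open>s\<^sub>1\<close> is given explicitly.\<close>

fun std :: "(nat \<Rightarrow> nat) \<Rightarrow> nat \<Rightarrow> nat list" where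
  "std a 0 = [0]"
| "std a (Suc 0) = replicate (a 1 - 1) 0 @ [1]"
| "std a (Suc (Suc k)) = word_pow (std a (Suc k)) (a (Suc (Suc k))) @ std a k"

definition std_inter :: "(nat \<Rightarrow> nat) \<Rightarrow> nat \<Rightarrow> nat \<Rightarrow> nat list" where
  "std_inter a k l = word_pow (std a (k - 1)) l @ std a (k - 2)"

text \<open>This cyclic shift moves the last letter to the front; it is inverse to \<^const>\<open>rotate1\<close>.\<close>

definition cyc :: "'a list \<Rightarrow> 'a list" where
  "cyc w = (if w = [] then [] else last w # butlast w)"

definition rot :: "real \<Rightarrow> real \<Rightarrow> real" where
  "rot \<alpha> x = frac (x + \<alpha>)"

definition sturmian :: "real \<Rightarrow> real \<Rightarrow> nat \<Rightarrow> nat" where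
  "sturmian \<alpha> x n = (if (rot \<alpha> ^^ n) x \<in> {0..<1 - \<alpha>} then 0 else 1)"

text \<open>The set of finite factors of the infinite word with slope \<open>\<alpha>\<close> and intercept \<open>x\<close>.
  For irrational \<open>\<alpha>\<close> it does not depend on \<open>x \<in> [0, 1)\<close>.\<close>

definition language :: "real \<Rightarrow> real \<Rightarrow> nat list set" where
  "language \<alpha> x = {map (sturmian \<alpha> x) [m..<m + n] | m n. True}"

definition cylinder :: "real \<Rightarrow> nat list \<Rightarrow> real set" where
  "cylinder \<alpha> w = {x \<in> {0..<1}. map (sturmian \<alpha> x) [0..<length w] = w}"

text \<open>A cylinder is an arc of the circle \<open>[0, 1)\<close>, possibly wrapping around \<open>0\<close>; the length of the
  arc is its Lebesgue measure as a subset of \<open>[0, 1)\<close>.\<close>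

definition arc_length :: "real set \<Rightarrow> real" where
  "arc_length A = measure lborel A"

definition dist_nearest_int :: "real \<Rightarrow> real" where
  "dist_nearest_int x = \<bar>x - of_int (round x)\<bar>"

end

theory Submission imports Defs begin

text \<open>Write \<open>N = q\<^sub>k\<^sub>,\<^sub>l\<close> and \<open>Q = q\<^sub>k\<^sub>-\<^sub>1\<close>. The cylinders of the words of length \<open>N\<close> are the arcs cut out by the
  \<open>N + 1\<close> points \<open>- j\<alpha>\<close> with \<open>0 \<le> j \<le> N\<close>; let \<open>W j\<close> be the word of length \<open>N\<close> read off from \<open>- j\<alpha>\<close>,
  the left endpoint of its arc. Since \<open>(N, P)\<close> and \<open>(Q, R)\<close>, with \<open>P\<close> and \<open>R\<close> the numerators, form a
  basis of the integer lattice and approximate \<open>\<alpha>\<close> from opposite sides, the next point to the right is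
  obtained from \<open>j\<close> by a shift by \<open>N\<close>, by \<open>Q\<close> or by \<open>N - Q\<close>, which gives the lengths of the arcs.
  Adding \<open>N\<alpha>\<close> almost never crosses an integer, so a cyclic shift turns \<open>W j\<close> into \<open>W (j + 1)\<close>, with
  one exceptional word left out of the cycle. Finally \<open>s\<^sub>k\<^sub>,\<^sub>l\<close> is a prefix of the characteristic word, whose
  reversal is \<open>W (N + 1)\<close>; that point lies in the arc of \<open>j = 1\<close> or of \<open>j = N + 1 - Q\<close>, depending on
  the parity of \<open>k\<close>, and this fixes where the cycle of conjugates starts.\<close>

section \<open>Coding of rotations\<close>

lemma rot_funpow:
  assumes "y \<in> {0..<1}"
  shows "(rot \<alpha> ^^ n) y = frac (y + real n * \<alpha>)"
proof (induction n)
  case 0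
  then show ?case using assms by simp
next
  case (Suc n)
  have "(rot \<alpha> ^^ Suc n) y = frac (frac (y + real n * \<alpha>) + \<alpha>)"
    by (simp only: funpow.simps o_apply Suc rot_def)
  also have "\<dots> = frac (y + real (Suc n) * \<alpha>)"
    by (simp add: algebra_simps)
  finally show ?case .
qed

text \<open>Adding \<open>\<alpha>\<close> passes an integer exactly when the fractional part lies
  in \<open>[1 - \<alpha>, 1)\<close>, so the letters are increments of a floor.\<close>

lemma sturmian_eq_floor_diff:
  assumes "0 < \<alpha>" "\<alpha> < 1" "y \<in> {0..<1}"
  shows "sturmian \<alpha> y n = nat (\<lfloor>y + real (Suc n) * \<alpha>\<rfloor> - \<lfloor>y + real n * \<alpha>\<rfloor>)"
proof -
  define z where "z = y + real n * \<alpha>"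
  have z: "y + real (Suc n) * \<alpha> = z + \<alpha>"
    by (simp add: z_def algebra_simps)
  have "frac \<alpha> = \<alpha>" "\<lfloor>\<alpha>\<rfloor> = 0"
    using assms by (auto simp: frac_eq floor_eq_iff)
  then have "\<lfloor>z + \<alpha>\<rfloor> = (if frac z + \<alpha> < 1 then \<lfloor>z\<rfloor> else \<lfloor>z\<rfloor> + 1)"
    by (simp add: floor_add)
  then show ?thesis
    unfolding z z_def[symmetric] sturmian_def rot_funpow[OF assms(3)] by auto
qed

definition sturmian_prefix :: "real \<Rightarrow> real \<Rightarrow> nat \<Rightarrow> nat list" where
  "sturmian_prefix \<alpha> y n = map (sturmian \<alpha> y) [0..<n]"

lemma length_sturmian_prefix [simp]: "length (sturmian_prefix \<alpha> y n) = n"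
  by (simp add: sturmian_prefix_def)

lemma cylinder_sturmian_prefix:
  "cylinder \<alpha> (sturmian_prefix \<alpha> y n)
     = {z \<in> {0..<1}. sturmian_prefix \<alpha> z n = sturmian_prefix \<alpha> y n}"
  by (simp add: cylinder_def sturmian_prefix_def)

text \<open>The factor at position \<open>m\<close> is a prefix of the word of the
  \<open>m\<close>-th orbit point, so membership in the language becomes a question of which
  cylinders the orbit visits.\<close>

lemma language_eq_sturmian_prefix:
  assumes "x \<in> {0..<1}"
  shows "language \<alpha> x = {sturmian_prefix \<alpha> (frac (x + real m * \<alpha>)) n | m n. True}"
proof -
  have "sturmian \<alpha> x (m + i) = sturmian \<alpha> (frac (x + real m * \<alpha>)) i" for m i
  proof -
    have fr: "frac (x + real m * \<alpha>) \<in> {0..<1}"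
      by (simp add: frac_lt_1)
    have "frac (frac (x + real m * \<alpha>) + real i * \<alpha>) = frac (x + real (m + i) * \<alpha>)"
      by (simp add: algebra_simps)
    then show ?thesis
      unfolding sturmian_def rot_funpow[OF assms] rot_funpow[OF fr] by simp
  qed
  then have "map (sturmian \<alpha> x) [m..<m + n] = sturmian_prefix \<alpha> (frac (x + real m * \<alpha>)) n" for m n
    by (intro nth_equalityI) (auto simp: sturmian_prefix_def)
  then show ?thesis
    by (simp add: language_def)
qed

section \<open>Cut points R^(-j)(0) of the circle and the arcs between them\<close>

definition backward_pt :: "real \<Rightarrow> nat \<Rightarrow> real" where
  "backward_pt \<alpha> j = frac (- (real j * \<alpha>))"

lemma backward_pt_0 [simp]: "backward_pt \<alpha> 0 = 0"
  by (simp add: backward_pt_def)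

lemma backward_pt_in [simp]: "0 \<le> backward_pt \<alpha> j" "backward_pt \<alpha> j < 1"
  by (simp_all add: backward_pt_def frac_lt_1)

lemma backward_pt_diff:
  obtains c where "backward_pt \<alpha> i - backward_pt \<alpha> j = of_int (int j - int i) * \<alpha> - of_int c"
proof
  show "backward_pt \<alpha> i - backward_pt \<alpha> j = of_int (int j - int i) * \<alpha>
      - of_int (\<lfloor>- (real i * \<alpha>)\<rfloor> - \<lfloor>- (real j * \<alpha>)\<rfloor>)"
    by (simp add: backward_pt_def frac_def algebra_simps)
qed

text \<open>The difference of \<open>y\<close> and a cut point lies in (-1, 1), so its floor only
  records their order; the rest depends on \<open>m\<close> alone.\<close>

lemma floor_orbit:
  assumes "y \<in> {0..<1}"
  shows "\<lfloor>y + real m * \<alpha>\<rfloor>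
    = (if backward_pt \<alpha> m \<le> y then 0 else - 1) - \<lfloor>- (real m * \<alpha>)\<rfloor>"
proof -
  have "y + real m * \<alpha> = (y - backward_pt \<alpha> m) - of_int \<lfloor>- (real m * \<alpha>)\<rfloor>"
    by (simp add: backward_pt_def frac_def)
  then have "\<lfloor>y + real m * \<alpha>\<rfloor> = \<lfloor>y - backward_pt \<alpha> m\<rfloor> - \<lfloor>- (real m * \<alpha>)\<rfloor>"
    by (metis floor_diff_of_int)
  moreover have "\<lfloor>y - backward_pt \<alpha> m\<rfloor> = (if backward_pt \<alpha> m \<le> y then 0 else - 1)"
    using assms backward_pt_in(1)[of \<alpha> m] backward_pt_in(2)[of \<alpha> m]
    by (auto simp: floor_eq_iff simp del: backward_pt_in)
  ultimately show ?thesis by simp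
qed

text \<open>Summing letters from floor 0 recovers the floors of all \<open>y + m \<alpha>\<close>
  with \<open>m \<le> n\<close>, and by \<open>floor_orbit\<close> these record on which side of
  each cut point \<open>y\<close> lies.\<close>

lemma sturmian_prefix_eq_iff:
  assumes "0 < \<alpha>" "\<alpha> < 1" "y \<in> {0..<1}" "z \<in> {0..<1}"
  shows "sturmian_prefix \<alpha> y n = sturmian_prefix \<alpha> z n
    \<longleftrightarrow> (\<forall>m\<le>n. backward_pt \<alpha> m \<le> y \<longleftrightarrow> backward_pt \<alpha> m \<le> z)"
proof -
  have fl: "\<lfloor>y + real m * \<alpha>\<rfloor> = \<lfloor>z + real m * \<alpha>\<rfloor>
      \<longleftrightarrow> (backward_pt \<alpha> m \<le> y \<longleftrightarrow> backward_pt \<alpha> m \<le> z)" for m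
    by (simp add: floor_orbit[OF assms(3)] floor_orbit[OF assms(4)])
  \<comment> \<open>Increments of the floor are nonnegative, so \<open>nat\<close> loses nothing and
    equal letters give equal increments.\<close>
  have mono: "\<lfloor>w + real m * \<alpha>\<rfloor> \<le> \<lfloor>w + real (Suc m) * \<alpha>\<rfloor>" for w m
    using assms(1) by (intro floor_mono) (simp add: algebra_simps)
  have "sturmian_prefix \<alpha> y n = sturmian_prefix \<alpha> z n
      \<longleftrightarrow> (\<forall>m<n. sturmian \<alpha> y m = sturmian \<alpha> z m)"
    by (auto simp: sturmian_prefix_def)
  also have "\<dots> \<longleftrightarrow> (\<forall>m\<le>n. \<lfloor>y + real m * \<alpha>\<rfloor> = \<lfloor>z + real m * \<alpha>\<rfloor>)"
  proof
    assume L: "\<forall>m<n. sturmian \<alpha> y m = sturmian \<alpha> z m"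
    have "m \<le> n \<Longrightarrow> \<lfloor>y + real m * \<alpha>\<rfloor> = \<lfloor>z + real m * \<alpha>\<rfloor>" for m
    proof (induction m)
      case 0
      have "\<lfloor>y\<rfloor> = 0" "\<lfloor>z\<rfloor> = 0"
        using assms by (simp_all add: floor_eq_iff)
      then show ?case by simp
    next
      case (Suc m)
      then have "sturmian \<alpha> y m = sturmian \<alpha> z m" "\<lfloor>y + real m * \<alpha>\<rfloor> = \<lfloor>z + real m * \<alpha>\<rfloor>"
        using L by auto
      then show ?case
        using mono[of y m] mono[of z m]
        unfolding sturmian_eq_floor_diff[OF assms(1,2,3)] sturmian_eq_floor_diff[OF assms(1,2,4)]
        by linarith
    qed
    then show "\<forall>m\<le>n. \<lfloor>y + real m * \<alpha>\<rfloor> = \<lfloor>z + real m * \<alpha>\<rfloor>" by blast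
  next
    assume R: "\<forall>m\<le>n. \<lfloor>y + real m * \<alpha>\<rfloor> = \<lfloor>z + real m * \<alpha>\<rfloor>"
    show "\<forall>m<n. sturmian \<alpha> y m = sturmian \<alpha> z m"
    proof (intro allI impI)
      fix m assume "m < n"
      then have "\<lfloor>y + real m * \<alpha>\<rfloor> = \<lfloor>z + real m * \<alpha>\<rfloor>"
        "\<lfloor>y + real (Suc m) * \<alpha>\<rfloor> = \<lfloor>z + real (Suc m) * \<alpha>\<rfloor>"
        using R by (meson less_imp_le Suc_leI)+
      then show "sturmian \<alpha> y m = sturmian \<alpha> z m"
        unfolding sturmian_eq_floor_diff[OF assms(1,2,3)] sturmian_eq_floor_diff[OF assms(1,2,4)]
        by simp
    qed
  qed
  finally show ?thesis by (simp add: fl)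
qed

lemma inj_backward_pt:
  assumes "\<alpha> \<notin> \<rat>" "backward_pt \<alpha> i = backward_pt \<alpha> j"
  shows "i = j"
proof (rule ccontr)
  assume "i \<noteq> j"
  obtain c where "backward_pt \<alpha> i - backward_pt \<alpha> j = of_int (int j - int i) * \<alpha> - of_int c"
    by (rule backward_pt_diff)
  then have "\<alpha> = of_int c / of_int (int j - int i)"
    using assms(2) \<open>i \<noteq> j\<close> by (simp add: field_simps)
  then show False
    using assms(1) by (metis Rats_divide Rats_of_int)
qed

text \<open>Both points are themselves cut points of index at most \<open>n\<close>, so equal words
  force each to be at most the other.\<close>

lemma sturmian_prefix_backward_pt_eq_iff:
  assumes "0 < \<alpha>" "\<alpha> < 1" "\<alpha> \<notin> \<rat>" "i \<le> n" "j \<le> n"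
  shows "sturmian_prefix \<alpha> (backward_pt \<alpha> i) n = sturmian_prefix \<alpha> (backward_pt \<alpha> j) n
    \<longleftrightarrow> i = j"
proof
  assume "sturmian_prefix \<alpha> (backward_pt \<alpha> i) n = sturmian_prefix \<alpha> (backward_pt \<alpha> j) n"
  then have "\<forall>m\<le>n. backward_pt \<alpha> m \<le> backward_pt \<alpha> i \<longleftrightarrow> backward_pt \<alpha> m \<le> backward_pt \<alpha> j"
    by (subst (asm) sturmian_prefix_eq_iff) (use assms in auto)
  then have "backward_pt \<alpha> i = backward_pt \<alpha> j"
    using assms(4,5) by (meson order.refl order.antisym)
  then show "i = j"
    by (rule inj_backward_pt[OF assms(3)])
qed simp

text \<open>The nearest cut point to the left of \<open>y\<close> serves; there is one because index
  0 gives the point 0.\<close>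

lemma sturmian_prefix_cover:
  assumes "0 < \<alpha>" "\<alpha> < 1" "y \<in> {0..<1}"
  obtains j where "j \<le> n" "sturmian_prefix \<alpha> y n = sturmian_prefix \<alpha> (backward_pt \<alpha> j) n"
proof -
  define S where "S = {m. m \<le> n \<and> backward_pt \<alpha> m \<le> y}"
  have S: "finite S" "S \<noteq> {}"
    using assms by (auto simp: S_def intro!: exI[of _ 0])
  define M where "M = Max (backward_pt \<alpha> ` S)"
  have "M \<in> backward_pt \<alpha> ` S"
    unfolding M_def using S by (intro Max_in) auto
  then obtain j where j: "j \<in> S" "M = backward_pt \<alpha> j"
    by auto
  have "backward_pt \<alpha> m \<le> backward_pt \<alpha> j" if "m \<in> S" for m
    unfolding j(2)[symmetric] M_def using S that by (intro Max_ge) auto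
  moreover have "backward_pt \<alpha> m \<le> y" if "backward_pt \<alpha> m \<le> backward_pt \<alpha> j" for m
    using that j(1) by (simp add: S_def)
  ultimately have "\<forall>m\<le>n. backward_pt \<alpha> m \<le> y \<longleftrightarrow> backward_pt \<alpha> m \<le> backward_pt \<alpha> j"
    by (auto simp: S_def)
  then have "sturmian_prefix \<alpha> y n = sturmian_prefix \<alpha> (backward_pt \<alpha> j) n"
    by (subst sturmian_prefix_eq_iff) (use assms in auto)
  with j(1) show ?thesis
    by (intro that) (auto simp: S_def)
qed

text \<open>Here \<open>g\<close> is the distance to the next cut point on the right:
  \<open>min\<close> excludes a closer one in any integer translate, and \<open>end_pt\<close> says
  that distance \<open>g\<close> is attained modulo 1.\<close>

lemma cylinder_backward_pt:
  assumes "0 < \<alpha>" "\<alpha> < 1" "j \<le> n" "j' \<le> n" "0 < g"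
    and end_pt: "backward_pt \<alpha> j + g - backward_pt \<alpha> j' \<in> \<int>"
    and min: "\<And>m c. \<lbrakk>m \<le> n; 0 < of_int (int j - int m) * \<alpha> - of_int c\<rbrakk>
      \<Longrightarrow> g \<le> of_int (int j - int m) * \<alpha> - of_int c"
  shows "cylinder \<alpha> (sturmian_prefix \<alpha> (backward_pt \<alpha> j) n)
      = {backward_pt \<alpha> j..<backward_pt \<alpha> j + g}"
    and "backward_pt \<alpha> j + g \<le> 1"
proof -
  have gap: "g \<le> backward_pt \<alpha> m - backward_pt \<alpha> j"
    if "m \<le> n" "backward_pt \<alpha> j < backward_pt \<alpha> m" for m
    using backward_pt_diff[of \<alpha> m j] min[OF that(1)] that(2) by (metis diff_gt_0_iff_gt)
  show le1: "backward_pt \<alpha> j + g \<le> 1"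
  proof -
    obtain c where c: "backward_pt \<alpha> 0 - backward_pt \<alpha> j = of_int (int j - int 0) * \<alpha> - of_int c"
      by (rule backward_pt_diff)
    \<comment> \<open>Lowering \<open>c\<close> by 1 replaces the cut point 0 by its copy at 1, so
      \<open>min\<close> keeps the arc from wrapping around.\<close>
    then have "of_int (int j - int 0) * \<alpha> - of_int (c - 1) = 1 - backward_pt \<alpha> j"
      by simp
    then show ?thesis
      using min[of 0 "c - 1"] backward_pt_in(2)[of \<alpha> j] by simp
  qed
  obtain d :: int where d: "backward_pt \<alpha> j + g - backward_pt \<alpha> j' = of_int d"
    using end_pt by (elim Ints_cases)
  \<comment> \<open>The end 1 stands for the cut point 0; it closes the last arc.\<close>
  have ends: "backward_pt \<alpha> j + g = 1 \<or> backward_pt \<alpha> j + g = backward_pt \<alpha> j'"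
  proof -
    have "- 1 < real_of_int d" "real_of_int d \<le> 1"
      using d le1 backward_pt_in[of \<alpha> j] backward_pt_in[of \<alpha> j'] \<open>0 < g\<close> by linarith+
    then have "d = 0 \<or> d = 1"
      by linarith
    then have "real_of_int d = 0 \<or> real_of_int d = 1"
      by auto
    then show ?thesis
      using d le1 backward_pt_in(1)[of \<alpha> j'] by linarith
  qed
  show "cylinder \<alpha> (sturmian_prefix \<alpha> (backward_pt \<alpha> j) n)
      = {backward_pt \<alpha> j..<backward_pt \<alpha> j + g}"
  proof (intro set_eqI iffI)
    fix y assume "y \<in> cylinder \<alpha> (sturmian_prefix \<alpha> (backward_pt \<alpha> j) n)"
    then have y: "y \<in> {0..<1}" "sturmian_prefix \<alpha> y n = sturmian_prefix \<alpha> (backward_pt \<alpha> j) n"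
      by (auto simp: cylinder_sturmian_prefix)
    then have same: "\<forall>m\<le>n. backward_pt \<alpha> m \<le> y \<longleftrightarrow> backward_pt \<alpha> m \<le> backward_pt \<alpha> j"
      by (subst (asm) sturmian_prefix_eq_iff) (use assms in auto)
    then have "backward_pt \<alpha> j \<le> y" "backward_pt \<alpha> j' \<le> y \<longleftrightarrow> backward_pt \<alpha> j' \<le> backward_pt \<alpha> j"
      using assms(3,4) by auto
    then show "y \<in> {backward_pt \<alpha> j..<backward_pt \<alpha> j + g}"
      using ends y(1) \<open>0 < g\<close> by auto
  next
    fix y assume y: "y \<in> {backward_pt \<alpha> j..<backward_pt \<alpha> j + g}"
    then have y01: "y \<in> {0..<1}"
      using le1 order.trans[OF backward_pt_in(1)[of \<alpha> j]] by auto
    have "backward_pt \<alpha> m \<le> y \<longleftrightarrow> backward_pt \<alpha> m \<le> backward_pt \<alpha> j" if "m \<le> n" for m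
      using gap[OF that] y by force
    then have "sturmian_prefix \<alpha> y n = sturmian_prefix \<alpha> (backward_pt \<alpha> j) n"
      by (subst sturmian_prefix_eq_iff) (use assms y01 in auto)
    then show "y \<in> cylinder \<alpha> (sturmian_prefix \<alpha> (backward_pt \<alpha> j) n)"
      using y01 by (simp add: cylinder_sturmian_prefix)
  qed
qed

text \<open>An orbit point within \<open>g / 2\<close> of the midpoint of the arc lies in the arc.
  This makes the word of every arc occur in the language, whatever the intercept.\<close>

lemma orbit_dense:
  assumes "\<alpha> \<notin> \<rat>" "0 \<le> p" "0 < g" "p + g \<le> 1"
  obtains m where "frac (x + real m * \<alpha>) \<in> {p..<p + g}"
proof -
  obtain h k where k: "k > 0" "\<bar>of_int k * \<alpha> - of_int h - (p + g / 2 - x)\<bar> < g / 2"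
    by (rule sequence_of_fractional_parts_is_dense[OF assms(1) half_gt_zero[OF assms(3)]])
  then have bounds: "p < x + of_int k * \<alpha> - of_int h" "x + of_int k * \<alpha> - of_int h < p + g"
    unfolding abs_less_iff by linarith+
  have "real (nat k) = of_int k"
    using k(1) by simp
  moreover have "frac (x + of_int k * \<alpha>) = x + of_int k * \<alpha> - of_int h"
    unfolding frac_unique_iff using bounds assms by auto
  ultimately show ?thesis
    using bounds by (intro that[of "nat k"]) auto
qed

section \<open>The two-sided mechanical word and the characteristic word\<close>

definition beatty :: "real \<Rightarrow> int \<Rightarrow> int" where
  "beatty \<alpha> h = \<lfloor>of_int h * \<alpha>\<rfloor>"

definition mech_letter :: "real \<Rightarrow> int \<Rightarrow> nat" where
  "mech_letter \<alpha> h = nat (beatty \<alpha> (h + 1) - beatty \<alpha> h)"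

text \<open>The characteristic word has intercept \<open>\<alpha>\<close> rather than 0, hence the
  index shift by 1.\<close>

definition char_prefix :: "real \<Rightarrow> nat \<Rightarrow> nat list" where
  "char_prefix \<alpha> n = map (\<lambda>m. mech_letter \<alpha> (int m + 1)) [0..<n]"

lemma length_char_prefix [simp]: "length (char_prefix \<alpha> n) = n"
  by (simp add: char_prefix_def)

lemma not_Ints_mult_irrational:
  assumes "\<alpha> \<notin> \<rat>" "h \<noteq> 0"
  shows "of_int h * \<alpha> \<noteq> of_int c"
proof
  assume "of_int h * \<alpha> = of_int c"
  then have "\<alpha> = of_int c / of_int h"
    using assms(2) by (simp add: field_simps)
  then show False
    using assms(1) by (metis Rats_divide Rats_of_int)
qed

lemma beatty_0 [simp]: "beatty \<alpha> 0 = 0"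
  by (simp add: beatty_def)

lemma beatty_minus:
  assumes "\<alpha> \<notin> \<rat>" "h \<noteq> 0"
  shows "beatty \<alpha> (- h) = - beatty \<alpha> h - 1"
proof -
  have "of_int (beatty \<alpha> h) \<le> of_int h * \<alpha>" "of_int h * \<alpha> < of_int (beatty \<alpha> h) + 1"
    by (simp_all add: beatty_def)
  then have "of_int (beatty \<alpha> h) < of_int h * \<alpha>" "of_int h * \<alpha> < of_int (beatty \<alpha> h) + 1"
    using not_Ints_mult_irrational[OF assms, of "beatty \<alpha> h"] by auto
  then show ?thesis
    unfolding beatty_def[of \<alpha> "- h"] by (intro floor_unique) auto
qed

text \<open>The floors at \<open>h\<close> and \<open>h + 1\<close> are both reflected by
  \<open>beatty_minus\<close>, which fails at 0; this excludes the indices 0 and -1.\<close>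

lemma mech_letter_reflect:
  assumes "\<alpha> \<notin> \<rat>" "h \<noteq> 0" "h \<noteq> - 1"
  shows "mech_letter \<alpha> (- h - 1) = mech_letter \<alpha> h"
  using beatty_minus[OF assms(1,2)] beatty_minus[OF assms(1), of "h + 1"] assms(3)
  by (simp add: mech_letter_def)

text \<open>Point \<open>j\<close> reaches 0 after \<open>j\<close> rotations, so all these words
  are windows of a single two-sided word.\<close>

lemma sturmian_prefix_backward_pt:
  assumes "0 < \<alpha>" "\<alpha> < 1"
  shows "sturmian_prefix \<alpha> (backward_pt \<alpha> j) n
    = map (\<lambda>m. mech_letter \<alpha> (int m - int j)) [0..<n]"
proof -
  have fl: "\<lfloor>backward_pt \<alpha> j + real m * \<alpha>\<rfloor> = beatty \<alpha> (int m - int j) - \<lfloor>- (real j * \<alpha>)\<rfloor>" for m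
  proof -
    have "backward_pt \<alpha> j + real m * \<alpha>
        = of_int (int m - int j) * \<alpha> - of_int \<lfloor>- (real j * \<alpha>)\<rfloor>"
      by (simp add: backward_pt_def frac_def algebra_simps)
    then show ?thesis
      unfolding beatty_def by (metis floor_diff_of_int)
  qed
  have idx: "int (Suc m) - int j = int m - int j + 1" for m
    by simp
  have "sturmian \<alpha> (backward_pt \<alpha> j) m = mech_letter \<alpha> (int m - int j)" for m
    by (subst sturmian_eq_floor_diff)
      (use assms in \<open>simp_all only: fl idx mech_letter_def, auto\<close>)
  then show ?thesis
    by (simp add: sturmian_prefix_def)
qed

text \<open>Reflection carries the indices 1, ..., n to -n-1, ..., -2, a window that avoids the
  exceptional indices -1 and 0.\<close>

lemma rev_char_prefix:
  assumes "0 < \<alpha>" "\<alpha> < 1" "\<alpha> \<notin> \<rat>"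
  shows "rev (char_prefix \<alpha> n) = sturmian_prefix \<alpha> (backward_pt \<alpha> (n + 1)) n"
proof (rule nth_equalityI)
  fix m assume "m < length (rev (char_prefix \<alpha> n))"
  then have m: "m < n" by simp
  have "rev (char_prefix \<alpha> n) ! m = mech_letter \<alpha> (int n - int m)"
    using m by (simp add: rev_nth char_prefix_def of_nat_diff)
  also have "\<dots> = mech_letter \<alpha> (- (int n - int m) - 1)"
    using m by (intro mech_letter_reflect[symmetric] assms(3)) auto
  also have "- (int n - int m) - 1 = int m - int (n + 1)"
    by simp
  finally show "rev (char_prefix \<alpha> n) ! m = sturmian_prefix \<alpha> (backward_pt \<alpha> (n + 1)) n ! m"
    using m assms by (simp add: sturmian_prefix_backward_pt)
qed simp

lemma cyc_map_upt:
  assumes "0 < n"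
  shows "cyc (map f [0..<n]) = map (\<lambda>m. if m = 0 then f (n - 1) else f (m - 1)) [0..<n]"
proof -
  obtain k where n: "n = Suc k"
    using assms by (cases n) auto
  have "cyc (map f [0..<n]) = f k # map f [0..<k]"
    by (simp add: cyc_def n)
  also have "\<dots> = map (\<lambda>m. if m = 0 then f (n - 1) else f (m - 1)) [0..<n]"
    by (rule nth_equalityI) (auto simp: n nth_Cons' simp del: upt_Suc)
  finally show ?thesis .
qed

lemma dist_nearest_int_eq:
  assumes "\<bar>x - of_int p\<bar> < 1 / 2"
  shows "dist_nearest_int x = \<bar>x - of_int p\<bar>"
  using round_unique'[OF assms] by (simp add: dist_nearest_int_def)

section \<open>Neighbouring convergents\<close>

text \<open>Intended instance: \<open>N = q\<^sub>k\<^sub>,\<^sub>l\<close> and \<open>Q = q\<^sub>k\<^sub>-\<^sub>1\<close> with numerators \<open>P\<close> and \<open>R\<close>, and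
  \<open>e = (-1)\<^sup>k\<close>. Then \<open>A\<close>, \<open>B\<close> and \<open>A + B\<close> below are the distances from \<open>N\<alpha>\<close>, \<open>Q\<alpha>\<close> and
  \<open>(N - Q)\<alpha>\<close> to the nearest integer.\<close>

locale farey_pair =
  fixes \<alpha> :: real and N Q :: nat and P R e :: int
  assumes irrational: "\<alpha> \<notin> \<rat>" and alpha_pos: "0 < \<alpha>" and alpha_less: "\<alpha> < 1 / 2"
    and sign: "e = 1 \<or> e = - 1"
    and Q_ge: "2 \<le> Q" and Q_less: "Q < N"
    and det: "int N * R - P * int Q = e"
    and posN: "0 < of_int e * (real N * \<alpha> - of_int P)"
    and posQ: "0 < of_int e * (of_int R - real Q * \<alpha>)"
    and small: "of_int e * (real N * \<alpha> - of_int P) + of_int e * (of_int R - real Q * \<alpha>) < 1 / 2"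
begin

definition A :: real where "A = of_int e * (real N * \<alpha> - of_int P)"
definition B :: real where "B = of_int e * (of_int R - real Q * \<alpha>)"

lemma A_pos: "0 < A" and B_pos: "0 < B" and AB_small: "A + B < 1 / 2"
  using posN posQ small by (auto simp: A_def B_def)

lemma alpha_less_1: "\<alpha> < 1"
  using alpha_less by simp

lemma ee: "e * e = 1"
  using sign by auto

lemma lattice_coords:
  obtains u v where "h = u * int N + v * int Q"
    and "of_int e * (of_int h * \<alpha> - of_int c) = of_int u * A - of_int v * B"
proof
  \<comment> \<open>Cramer's rule: multiplying by \<open>e\<close>, its own inverse, divides by the
    determinant. The linear form becomes \<open>u A - v B\<close> because the two approximations lie
    on opposite sides of \<open>\<alpha>\<close>.\<close>
  define u where "u = e * (h * R - c * int Q)"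
  define v where "v = e * (int N * c - h * P)"
  have "u * int N + v * int Q = e * h * (int N * R - P * int Q)"
    by (simp add: u_def v_def algebra_simps)
  also have "\<dots> = (e * e) * h"
    by (simp add: det)
  finally show h: "h = u * int N + v * int Q"
    by (simp add: ee)
  have "u * P + v * R = e * c * (int N * R - P * int Q)"
    by (simp add: u_def v_def algebra_simps)
  also have "\<dots> = (e * e) * c"
    by (simp add: det)
  finally have c: "c = u * P + v * R"
    by (simp add: ee)
  show "of_int e * (of_int h * \<alpha> - of_int c) = of_int u * A - of_int v * B"
    by (simp add: h c A_def B_def algebra_simps)
qed

text \<open>In lattice coordinates, \<open>u\<close> and \<open>v\<close> nonzero of equal sign make
  \<open>h\<close> exceed \<open>N\<close> in absolute value, while opposite signs push the form to
  at least \<open>A + B\<close> or below 0. Only \<open>u = 1, v = 0\<close> and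
  \<open>u = 0, v < 0\<close> survive; the \<open>v\<close> of the conclusion is the negated
  coordinate.\<close>

lemma best_approximation:
  assumes "\<bar>h\<bar> \<le> int N"
    and "0 < of_int e * (of_int h * \<alpha> - of_int c)"
    and "of_int e * (of_int h * \<alpha> - of_int c) < A + B"
  shows "(h = int N \<and> of_int e * (of_int h * \<alpha> - of_int c) = A)
    \<or> (\<exists>v\<ge>1. h = - v * int Q \<and> B \<le> of_int e * (of_int h * \<alpha> - of_int c))"
proof -
  obtain u v where h: "h = u * int N + v * int Q"
    and d: "of_int e * (of_int h * \<alpha> - of_int c) = of_int u * A - of_int v * B"
    by (rule lattice_coords)
  note bounds = assms[unfolded d]
  have mono: "of_int x * A \<le> of_int y * A" "of_int x * B \<le> of_int y * B" if "x \<le> y" for x y :: int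
    using that A_pos B_pos by (simp_all add: mult_right_mono)
  have imono: "x * int N \<le> y * int N" "x * int Q \<le> y * int Q" if "x \<le> y" for x y :: int
    using that by (simp_all add: mult_right_mono)
  consider "1 \<le> u" | "u = 0" | "u \<le> - 1" by linarith
  then show ?thesis
  proof cases
    case 1
    consider "1 \<le> v" | "v = 0" | "v \<le> - 1" by linarith
    then show ?thesis
    proof cases
      case vpos: 1
      then have False
        using imono(1)[OF 1] imono(2)[OF vpos] h assms(1) Q_ge by linarith
      then show ?thesis ..
    next
      case v0: 2
      have "u = 1"
      proof (rule ccontr)
        assume "u \<noteq> 1"
        with 1 have "2 \<le> u" by simp
        then show False
          using imono(1)[of 2 u] h v0 assms(1) Q_less by simp
      qed
      then show ?thesis
        using h d v0 by simp
    next
      case vneg: 3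
      have False
        using mono(1)[OF 1] mono(2)[OF vneg] bounds(3) by simp
      then show ?thesis ..
    qed
  next
    case 2
    have "v \<le> - 1"
    proof (rule ccontr)
      assume "\<not> v \<le> - 1"
      then have "0 \<le> v" by simp
      then show False
        using mono(2)[of 0 v] bounds(2) 2 by simp
    qed
    then have "B \<le> of_int u * A - of_int v * B"
      using mono(2)[of v "- 1"] 2 by simp
    then show ?thesis
      using \<open>v \<le> - 1\<close> h d 2 by (intro disjI2 exI[of _ "- v"]) simp
  next
    case 3
    consider "v \<le> - 1" | "0 \<le> v" by linarith
    then have False
    proof cases
      case vneg: 1
      then show False
        using imono(1)[OF 3] imono(2)[OF vneg] h assms(1) Q_ge by linarith
    next
      case vnn: 2
      then show False
        using mono(1)[OF 3] mono(2)[OF vnn] bounds(2) A_pos by simp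
    qed
    then show ?thesis ..
  qed
qed

section \<open>The three arc lengths and the order in which conjugates visit the arcs\<close>

definition singular_index :: nat where
  "singular_index = (if e = 1 then N else 0)"

text \<open>Distance from point \<open>j\<close> to the next cut point. The points 0 and
  \<open>N\<close> are \<open>A\<close> apart, and \<open>singular_index\<close> is the left one; a
  shift of the index by \<open>Q\<close> costs \<open>B\<close>, and where that leaves the range 0,
  ..., N a shift by \<open>N - Q\<close> costs \<open>A + B\<close>.\<close>

definition gap :: "nat \<Rightarrow> real" where
  "gap j = (if j = singular_index then A
     else if e = 1 \<and> j + Q \<le> N \<or> e = - 1 \<and> Q \<le> j then B else A + B)"

text \<open>For \<open>e = 1\<close> the cycle runs through N+1-Q, ..., N-1, jumps over
  \<open>N\<close>, and continues with 0, ..., N-Q; for \<open>e = - 1\<close> it is 1, ...,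
  N.\<close>

definition conj_index :: "nat \<Rightarrow> nat" where
  "conj_index i = (if e = 1 then if i + 1 < Q then N + 1 - Q + i else i + 1 - Q else i + 1)"

lemma plus_simps:
  assumes "e = 1"
  shows "A = real N * \<alpha> - of_int P" "B = of_int R - real Q * \<alpha>" "singular_index = N"
    "gap j = (if j = N then A else if j + Q \<le> N then B else A + B)"
    "conj_index i = (if i + 1 < Q then N + 1 - Q + i else i + 1 - Q)"
  unfolding gap_def A_def B_def singular_index_def conj_index_def by (simp_all add: assms)

lemma minus_simps:
  assumes "e = - 1"
  shows "A = of_int P - real N * \<alpha>" "B = real Q * \<alpha> - of_int R" "singular_index = 0"
    "gap j = (if j = 0 then A else if Q \<le> j then B else A + B)"
    "conj_index i = i + 1"
  unfolding gap_def A_def B_def singular_index_def conj_index_def by (simp_all add: assms)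

lemma gap_pos: "0 < gap j" and gap_le: "gap j \<le> A + B"
  using A_pos B_pos by (auto simp: gap_def)

text \<open>A smaller distance would be below \<open>A + B\<close>, so
  \<open>best_approximation\<close> applies: an index difference \<open>N\<close> forces the
  singular index, and one of at least \<open>Q\<close> leaves room for the shift by
  \<open>Q\<close>, where the gap is already at most \<open>B\<close>.\<close>

lemma gap_minimal:
  assumes "j \<le> N" "m \<le> N" "0 < of_int (int j - int m) * \<alpha> - of_int c"
  shows "gap j \<le> of_int (int j - int m) * \<alpha> - of_int c"
proof (rule ccontr)
  assume "\<not> gap j \<le> of_int (int j - int m) * \<alpha> - of_int c"
  then have lt: "of_int (int j - int m) * \<alpha> - of_int c < gap j" by simp
  define h where "h = e * (int j - int m)"
  have eq: "of_int e * (of_int h * \<alpha> - of_int (e * c)) = of_int (int j - int m) * \<alpha> - of_int c"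
    using sign by (auto simp: h_def algebra_simps)
  have "\<bar>h\<bar> \<le> int N"
    using sign assms by (auto simp: h_def)
  from best_approximation[OF this, of "e * c", unfolded eq] lt gap_le[of j] assms(3)
  consider "h = int N" "of_int (int j - int m) * \<alpha> - of_int c = A"
    | v where "v \<ge> 1" "h = - v * int Q" "B \<le> of_int (int j - int m) * \<alpha> - of_int c"
    by auto
  then show False
  proof cases
    case 1
    then have "j = singular_index"
      using sign assms by (auto simp: h_def singular_index_def)
    then show False
      using 1 lt by (simp add: gap_def)
  next
    case 2
    have "h \<le> - int Q"
      using 2(1,2) mult_right_mono[of 1 v "int Q"] by simp
    then have "e = 1 \<and> j + Q \<le> N \<or> e = - 1 \<and> Q \<le> j"
      using sign assms(1,2) by (auto simp: h_def)
    moreover from this have "j \<noteq> singular_index"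
      using Q_ge by (auto simp: singular_index_def)
    ultimately show False
      using 2(3) lt by (simp add: gap_def)
  qed
qed

text \<open>The three cases of \<open>gap\<close> come with explicit right neighbours: the other one
  of 0 and \<open>N\<close>, then the index shifted by \<open>Q\<close>, then by
  \<open>N - Q\<close>, in the direction given by \<open>e\<close>.\<close>

lemma gap_end:
  assumes "j \<le> N"
  obtains j' where "j' \<le> N" "backward_pt \<alpha> j + gap j - backward_pt \<alpha> j' \<in> \<int>"
proof -
  note end_ptI = that
  have *: thesis if j': "j' \<le> N" "of_int (int j' - int j) * \<alpha> + gap j = of_int d" for j' d
  proof -
    obtain c where "backward_pt \<alpha> j - backward_pt \<alpha> j' = of_int (int j' - int j) * \<alpha> - of_int c"
      by (rule backward_pt_diff)
    then have "backward_pt \<alpha> j + gap j - backward_pt \<alpha> j' = of_int (d - c)"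
      using j'(2) by simp
    then show thesis
      using end_ptI[OF j'(1)] by simp
  qed
  from sign show thesis
  proof
    assume e: "e = 1"
    note E = plus_simps[OF e]
    consider "j = N" | "j \<noteq> N" "j + Q \<le> N" | "j \<noteq> N" "\<not> j + Q \<le> N" by blast
    then show thesis
    proof cases
      case 1
      then show thesis
        by (intro *[of 0 "- P"]) (simp_all add: E)
    next
      case 2
      then show thesis
        by (intro *[of "j + Q" R]) (simp_all add: E)
    next
      case 3
      then show thesis
        using assms Q_less by (intro *[of "j + Q - N" "R - P"])
          (simp_all add: E of_nat_diff algebra_simps)
    qed
  next
    assume e: "e = - 1"
    note E = minus_simps[OF e]
    consider "j = 0" | "j \<noteq> 0" "Q \<le> j" | "j \<noteq> 0" "\<not> Q \<le> j" by blast
    then show thesis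
    proof cases
      case 1
      then show thesis
        by (intro *[of N P]) (simp_all add: E)
    next
      case 2
      then show thesis
        using assms by (intro *[of "j - Q" "- R"])
          (simp_all add: E of_nat_diff algebra_simps)
    next
      case 3
      then show thesis
        using assms Q_less by (intro *[of "j + N - Q" "P - R"])
          (simp_all add: E of_nat_diff algebra_simps)
    qed
  qed
qed

section \<open>The words of length \<open>N\<close> in the language\<close>

definition W :: "nat \<Rightarrow> nat list" where
  "W j = sturmian_prefix \<alpha> (backward_pt \<alpha> j) N"

lemma W_eq_map: "W j = map (\<lambda>m. mech_letter \<alpha> (int m - int j)) [0..<N]"
  unfolding W_def by (rule sturmian_prefix_backward_pt[OF alpha_pos alpha_less_1])

lemma cylinder_W:
  assumes "j \<le> N"
  shows "cylinder \<alpha> (W j) = {backward_pt \<alpha> j..<backward_pt \<alpha> j + gap j}"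
    and "backward_pt \<alpha> j + gap j \<le> 1"
proof -
  obtain j' where j': "j' \<le> N" "backward_pt \<alpha> j + gap j - backward_pt \<alpha> j' \<in> \<int>"
    using gap_end[OF assms] .
  note * = cylinder_backward_pt[OF alpha_pos alpha_less_1 assms j'(1) gap_pos j'(2)
      gap_minimal[OF assms], folded W_def]
  from * show "cylinder \<alpha> (W j) = {backward_pt \<alpha> j..<backward_pt \<alpha> j + gap j}"
    by blast
  from * show "backward_pt \<alpha> j + gap j \<le> 1"
    by blast
qed

lemma arc_length_W: "j \<le> N \<Longrightarrow> arc_length (cylinder \<alpha> (W j)) = gap j"
  using gap_pos[of j] by (simp add: cylinder_W arc_length_def)

lemma W_inject: "i \<le> N \<Longrightarrow> j \<le> N \<Longrightarrow> W i = W j \<longleftrightarrow> i = j"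
  unfolding W_def
  by (rule sturmian_prefix_backward_pt_eq_iff[OF alpha_pos alpha_less_1 irrational])

text \<open>Every orbit point lies in one of the \<open>N + 1\<close> arcs, and conversely each arc
  has positive length and is therefore visited.\<close>

lemma language_length_N:
  assumes "x \<in> {0..<1}"
  shows "{u \<in> language \<alpha> x. length u = N} = W ` {..N}"
proof (intro set_eqI iffI)
  fix u assume "u \<in> {u \<in> language \<alpha> x. length u = N}"
  then obtain m where u: "u = sturmian_prefix \<alpha> (frac (x + real m * \<alpha>)) N"
    by (auto simp: language_eq_sturmian_prefix[OF assms])
  have "frac (x + real m * \<alpha>) \<in> {0..<1}"
    by (simp add: frac_lt_1)
  then show "u \<in> W ` {..N}"
    unfolding u W_def
    by (rule sturmian_prefix_cover[OF alpha_pos alpha_less_1, where n = N]) auto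
next
  fix u assume "u \<in> W ` {..N}"
  then obtain j where j: "j \<le> N" "u = W j" by auto
  obtain m where "frac (x + real m * \<alpha>) \<in> {backward_pt \<alpha> j..<backward_pt \<alpha> j + gap j}"
    using orbit_dense[OF irrational backward_pt_in(1) gap_pos cylinder_W(2)[OF j(1)]] .
  then have "frac (x + real m * \<alpha>) \<in> cylinder \<alpha> (W j)"
    by (simp add: cylinder_W j(1))
  then have "W j = sturmian_prefix \<alpha> (frac (x + real m * \<alpha>)) N"
    by (simp add: W_def cylinder_sturmian_prefix)
  then show "u \<in> {u \<in> language \<alpha> x. length u = N}"
    unfolding j(2) language_eq_sturmian_prefix[OF assms] by (auto simp: W_def)
qed

section \<open>Almost-periods \<open>N\<close> and \<open>Q\<close> of the Beatty sequence\<close>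

lemma beatty_add_N:
  assumes "e = 1 \<and> - int N < h \<and> h \<le> 0 \<or> e = - 1 \<and> - int N \<le> h \<and> h < 0"
  shows "beatty \<alpha> (h + int N) = beatty \<alpha> h + P"
proof -
  \<comment> \<open>For the values of \<open>c\<close> used below, this is the distance from
    \<open>h \<alpha>\<close> to the next integer in the direction of the shift by \<open>A\<close>.
    Equality with \<open>A\<close> occurs for \<open>e = - 1\<close> and \<open>h = - N\<close>,
    where the sum lands on 0 and the floor is still right.\<close>
  have no: "A < of_int e * (of_int (- h) * \<alpha> - of_int c)
      \<or> of_int e * (of_int (- h) * \<alpha> - of_int c) \<le> 0
      \<or> e = - 1 \<and> of_int e * (of_int (- h) * \<alpha> - of_int c) = A" for c
  proof (rule ccontr)
    assume neg: "\<not> ?thesis"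
    then have "of_int e * (of_int (- h) * \<alpha> - of_int c) < A + B"
      "0 < of_int e * (of_int (- h) * \<alpha> - of_int c)"
      using B_pos by auto
    moreover have "\<bar>- h\<bar> \<le> int N"
      using assms by auto
    ultimately consider "- h = int N" "of_int e * (of_int (- h) * \<alpha> - of_int c) = A"
      | v where "v \<ge> 1" "- h = - v * int Q"
      using best_approximation[of "- h" c] by blast
    then show False
    proof cases
      case 1
      then show False using neg assms by auto
    next
      case 2
      then have "int Q \<le> h"
        using mult_right_mono[of 1 v "int Q"] by simp
      then show False using assms Q_ge by auto
    qed
  qed
  have fl: "of_int (beatty \<alpha> h) \<le> of_int h * \<alpha>" "of_int h * \<alpha> < of_int (beatty \<alpha> h) + 1"
    by (auto simp: beatty_def)
  from sign show ?thesis
  proof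
    assume e: "e = 1"
    have "of_int (h + int N) * \<alpha> = of_int h * \<alpha> + of_int P + A"
      unfolding A_def by (simp add: e algebra_simps)
    moreover have "of_int h * \<alpha> + A < of_int (beatty \<alpha> h) + 1"
      using no[of "- beatty \<alpha> h - 1"] fl by (simp add: e)
    ultimately show ?thesis
      unfolding beatty_def[of \<alpha> "h + int N"] using fl A_pos by (intro floor_unique) auto
  next
    assume e: "e = - 1"
    then have "h \<noteq> 0" using assms by auto
    then have "of_int (beatty \<alpha> h) < of_int h * \<alpha>"
      using fl(1) not_Ints_mult_irrational[OF irrational, of h "beatty \<alpha> h"] by simp
    moreover have "of_int (h + int N) * \<alpha> = of_int h * \<alpha> + of_int P - A"
      unfolding A_def by (simp add: e algebra_simps)
    ultimately show ?thesis
      unfolding beatty_def[of \<alpha> "h + int N"] using fl A_pos no[of "- beatty \<alpha> h"] e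
      by (intro floor_unique) auto
  qed
qed

lemma beatty_add_Q:
  assumes "1 \<le> h" "h \<le> int N + 1 - int Q"
  shows "beatty \<alpha> (h + int Q) = beatty \<alpha> h + R"
proof -
  have no: "B \<le> of_int e * (of_int h * \<alpha> - of_int c)
      \<or> of_int e * (of_int h * \<alpha> - of_int c) \<le> 0" for c
  proof (rule ccontr)
    assume neg: "\<not> ?thesis"
    then have "of_int e * (of_int h * \<alpha> - of_int c) < A + B"
      "0 < of_int e * (of_int h * \<alpha> - of_int c)"
      using A_pos by auto
    moreover have "\<bar>h\<bar> \<le> int N"
      using assms Q_ge by auto
    ultimately consider "h = int N"
      | v where "v \<ge> 1" "h = - v * int Q"
      using best_approximation[of h c] by blast
    then show False
    proof cases
      case 1
      then show False using assms Q_ge by auto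
    next
      case 2
      then have "h \<le> - int Q"
        using mult_right_mono[of 1 v "int Q"] by simp
      then show False using assms by auto
    qed
  qed
  have "of_int (beatty \<alpha> h) \<le> of_int h * \<alpha>" "of_int h * \<alpha> < of_int (beatty \<alpha> h) + 1"
    by (simp_all add: beatty_def)
  then have fl: "of_int (beatty \<alpha> h) < of_int h * \<alpha>" "of_int h * \<alpha> < of_int (beatty \<alpha> h) + 1"
    using not_Ints_mult_irrational[OF irrational, of h "beatty \<alpha> h"] assms(1) by auto
  from sign show ?thesis
  proof
    assume e: "e = 1"
    have "of_int (h + int Q) * \<alpha> = of_int h * \<alpha> + of_int R - B"
      unfolding B_def by (simp add: e algebra_simps)
    then show ?thesis
      unfolding beatty_def[of \<alpha> "h + int Q"] using fl B_pos no[of "beatty \<alpha> h"] e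
      by (intro floor_unique) auto
  next
    assume e: "e = - 1"
    have "of_int (h + int Q) * \<alpha> = of_int h * \<alpha> + of_int R + B"
      unfolding B_def by (simp add: e algebra_simps)
    \<comment> \<open>The bound in \<open>no\<close> is weak, but an upward shift needs a strict
      one; equality would make \<open>(h + Q) \<alpha>\<close> an integer.\<close>
    moreover have "of_int h * \<alpha> + B \<noteq> of_int (beatty \<alpha> h) + 1"
    proof
      assume "of_int h * \<alpha> + B = of_int (beatty \<alpha> h) + 1"
      then have "of_int (h + int Q) * \<alpha> = of_int (beatty \<alpha> h + 1 + R)"
        unfolding B_def by (simp add: e algebra_simps)
      moreover have "h + int Q \<noteq> 0"
        using assms(1) by linarith
      ultimately show False
        using not_Ints_mult_irrational[OF irrational] by blast
    qed
    ultimately show ?thesis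
      unfolding beatty_def[of \<alpha> "h + int Q"] using fl B_pos no[of "beatty \<alpha> h + 1"] e
      by (intro floor_unique) auto
  qed
qed

text \<open>The first \<open>N\<close> letters have period \<open>Q\<close>, since the floors
  involved differ by the constant \<open>R\<close>. The last letter uses the floor at
  \<open>N + 1 - Q\<close>, the end of the range in \<open>beatty_add_Q\<close>. In words this is
  \<open>s_{k,l} = s_{k-1} s_{k,l-1}\<close>.\<close>

lemma char_prefix_split: "char_prefix \<alpha> N = char_prefix \<alpha> Q @ char_prefix \<alpha> (N - Q)"
proof (rule nth_equalityI)
  show "length (char_prefix \<alpha> N) = length (char_prefix \<alpha> Q @ char_prefix \<alpha> (N - Q))"
    using Q_less by simp
  fix m assume "m < length (char_prefix \<alpha> N)"
  then have m: "m < N" by simp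
  show "char_prefix \<alpha> N ! m = (char_prefix \<alpha> Q @ char_prefix \<alpha> (N - Q)) ! m"
  proof (cases "m < Q")
    case True
    then show ?thesis
      using m by (simp add: nth_append char_prefix_def)
  next
    case False
    define r where "r = m - Q"
    have r: "m = r + Q" "r < N - Q"
      using False m by (auto simp: r_def)
    have "beatty \<alpha> (int r + 1 + int Q) = beatty \<alpha> (int r + 1) + R"
      "beatty \<alpha> (int r + 2 + int Q) = beatty \<alpha> (int r + 2) + R"
      using r by (intro beatty_add_Q; simp)+
    then have "mech_letter \<alpha> (int m + 1) = mech_letter \<alpha> (int r + 1)"
      by (simp add: mech_letter_def r(1) add_ac)
    then show ?thesis
      using m r False by (simp add: nth_append char_prefix_def)
  qed
qed

section \<open>The cyclic shift on the words \<open>W j\<close>\<close>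

lemma cyc_W:
  "cyc (W j) = map (\<lambda>m. mech_letter \<alpha> (if m = 0 then int N - 1 - int j else int m - 1 - int j)) [0..<N]"
proof -
  have N: "0 < N" using Q_less by simp
  then show ?thesis
    unfolding W_eq_map cyc_map_upt[OF N] by (intro map_cong) (auto simp: of_nat_diff)
qed

text \<open>The shifted word is the window starting one index earlier, except that its first letter
  comes from \<open>N - 1 - j\<close> instead of \<open>- 1 - j\<close>; the almost-period
  \<open>N\<close> makes these letters equal.\<close>

lemma cyc_W_Suc:
  assumes "e = 1 \<and> j + 1 < N \<or> e = - 1 \<and> 1 \<le> j \<and> j < N"
  shows "cyc (W j) = W (j + 1)"
proof -
  have "beatty \<alpha> (- int j + int N) = beatty \<alpha> (- int j) + P"
    "beatty \<alpha> (- 1 - int j + int N) = beatty \<alpha> (- 1 - int j) + P"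
    using assms by (intro beatty_add_N; force)+
  then have "mech_letter \<alpha> (int N - 1 - int j) = mech_letter \<alpha> (- 1 - int j)"
    by (simp add: mech_letter_def algebra_simps)
  then show ?thesis
    unfolding cyc_W W_eq_map[of "j + 1"] by (intro map_cong) (auto simp: algebra_simps)
qed

text \<open>The first letter after the shift has index 0, as in \<open>W 0\<close>, and the other
  letters agree by the almost-period \<open>N\<close>. The cycle thus passes over the singular word
  \<open>W N\<close>.\<close>

lemma cyc_W_wrap:
  assumes "e = 1"
  shows "cyc (W (N - 1)) = W 0"
proof -
  have "mech_letter \<alpha> (int m - int N) = mech_letter \<alpha> (int m)" if "0 < m" "m < N" for m
  proof -
    have "beatty \<alpha> (int m - int N + int N) = beatty \<alpha> (int m - int N) + P"
      "beatty \<alpha> (int m - int N + 1 + int N) = beatty \<alpha> (int m - int N + 1) + P"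
      using assms that by (intro beatty_add_N; force)+
    then show ?thesis
      by (simp add: mech_letter_def algebra_simps)
  qed
  then show ?thesis
    unfolding cyc_W W_eq_map[of 0] using Q_less by (intro map_cong) (auto simp: of_nat_diff)
qed

text \<open>Point \<open>i\<close> lies at distance \<open>t\<close> to the right of point
  \<open>j\<close>, inside its arc. The index \<open>i\<close> may exceed \<open>N\<close>, as it
  does for the reversed characteristic prefix.\<close>

lemma W_eqI:
  assumes "j \<le> N" "0 \<le> t" "t < gap j" "of_int (int i - int j) * \<alpha> + t = of_int d"
  shows "W i = W j"
proof -
  have "backward_pt \<alpha> i = backward_pt \<alpha> j + t"
  proof -
    have "- (real i * \<alpha>) - (backward_pt \<alpha> j + t) = of_int (\<lfloor>- (real j * \<alpha>)\<rfloor> - d)"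
      using assms(4) by (simp add: backward_pt_def frac_def algebra_simps)
    then have "- (real i * \<alpha>) - (backward_pt \<alpha> j + t) \<in> \<int>"
      by (metis Ints_of_int)
    moreover have "backward_pt \<alpha> j + t < 1"
      using cylinder_W(2)[OF assms(1)] assms(3) by simp
    ultimately show ?thesis
      unfolding backward_pt_def[of \<alpha> i] frac_unique_iff using assms(2) by simp
  qed
  then have "backward_pt \<alpha> i \<in> cylinder \<alpha> (W j)"
    using cylinder_W[OF assms(1)] assms by simp
  then show ?thesis
    by (simp add: W_def cylinder_sturmian_prefix)
qed

text \<open>Point \<open>N + 1\<close> lies \<open>B\<close> to the right of point
  \<open>N + 1 - Q\<close> if \<open>e = 1\<close>, and \<open>A\<close> to the right of point 1 if
  \<open>e = - 1\<close>. By \<open>2 \<le> Q\<close> either arc has length \<open>A + B\<close>, so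
  it contains that point.\<close>

lemma rev_char_prefix_eq_W: "rev (char_prefix \<alpha> N) = W (conj_index 0)"
proof -
  have "rev (char_prefix \<alpha> N) = W (N + 1)"
    unfolding W_def by (rule rev_char_prefix[OF alpha_pos alpha_less_1 irrational])
  also have "W (N + 1) = W (conj_index 0)"
    using sign
  proof
    assume e: "e = 1"
    note E = plus_simps[OF e]
    have "Suc N - Q \<noteq> N"
      using Q_ge Q_less by linarith
    then show ?thesis
      using Q_ge Q_less A_pos B_pos
      by (intro W_eqI[of _ B _ R])
        (simp_all add: E of_nat_diff algebra_simps)
  next
    assume e: "e = - 1"
    note E = minus_simps[OF e]
    show ?thesis
      using Q_ge Q_less A_pos B_pos
      by (intro W_eqI[of _ A _ P])
        (simp_all add: E algebra_simps)
  qed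
  finally show ?thesis .
qed

lemma conjugate_eq_W:
  assumes "i < N"
  shows "(cyc ^^ i) (rev (char_prefix \<alpha> N)) = W (conj_index i)"
  using assms
proof (induction i)
  case 0
  then show ?case by (simp add: rev_char_prefix_eq_W)
next
  case (Suc i)
  then have "(cyc ^^ Suc i) (rev (char_prefix \<alpha> N)) = cyc (W (conj_index i))"
    by simp
  also have "\<dots> = W (conj_index (Suc i))"
    using sign
  proof
    assume e: "e = 1"
    note E = plus_simps[OF e]
    consider "i + 1 < Q" "i + 2 \<noteq> Q" | "i + 2 = Q" | "Q \<le> i + 1" by linarith
    then show ?thesis
    proof cases
      case 1
      then have "conj_index (Suc i) = conj_index i + 1" "conj_index i + 1 < N"
        using Q_less by (auto simp: E)
      then show ?thesis
        using cyc_W_Suc e by simp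
    next
      case 2
      then have "conj_index (Suc i) = 0" "conj_index i = N - 1"
        using Q_less by (auto simp: E)
      then show ?thesis
        using cyc_W_wrap e by simp
    next
      case 3
      then have "conj_index (Suc i) = conj_index i + 1" "conj_index i + 1 < N"
        using Q_less Q_ge Suc.prems by (auto simp: E)
      then show ?thesis
        using cyc_W_Suc e by simp
    qed
  next
    assume e: "e = - 1"
    note E = minus_simps[OF e]
    have "cyc (W (i + 1)) = W (i + 1 + 1)"
      using e Suc.prems by (intro cyc_W_Suc) simp
    then show ?thesis
      by (simp add: E)
  qed
  finally show ?case .
qed

lemma conj_index_le: "i < N \<Longrightarrow> conj_index i \<le> N"
  using Q_less by (auto simp: conj_index_def)

lemma image_conj_index: "conj_index ` {..<N} = {..N} - {singular_index}"
proof (intro set_eqI iffI)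
  fix j assume "j \<in> conj_index ` {..<N}"
  then show "j \<in> {..N} - {singular_index}"
    using Q_less Q_ge sign by (auto simp: conj_index_def singular_index_def split: if_splits)
next
  fix j assume j: "j \<in> {..N} - {singular_index}"
  from sign show "j \<in> conj_index ` {..<N}"
  proof
    assume e: "e = 1"
    note E = plus_simps[OF e]
    show ?thesis
    proof (cases "j + Q \<le> N")
      case True
      then have "j = conj_index (j + Q - 1)" "j + Q - 1 < N"
        using Q_ge by (auto simp: E)
      then show ?thesis by blast
    next
      case False
      then have "j = conj_index (j + Q - N - 1)" "j + Q - N - 1 < N"
        using Q_less Q_ge j by (auto simp: E)
      then show ?thesis by blast
    qed
  next
    assume e: "e = - 1"
    note E = minus_simps[OF e]
    have "j = conj_index (j - 1)" "j - 1 < N"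
      using j by (auto simp: E)
    then show ?thesis by blast
  qed
qed

section \<open>Distances to the nearest integer and the result for a pair of convergents\<close>

lemma dist_nearest_int_N: "dist_nearest_int (real N * \<alpha>) = A"
proof -
  have "\<bar>real N * \<alpha> - of_int P\<bar> = A"
    using sign A_pos by (auto simp: A_def)
  moreover have "A < 1 / 2"
    using B_pos AB_small by simp
  ultimately show ?thesis
    by (metis dist_nearest_int_eq)
qed

lemma dist_nearest_int_Q: "dist_nearest_int (real Q * \<alpha>) = B"
proof -
  have "\<bar>real Q * \<alpha> - of_int R\<bar> = B"
    using sign B_pos by (auto simp: B_def)
  moreover have "B < 1 / 2"
    using A_pos AB_small by simp
  ultimately show ?thesis
    by (metis dist_nearest_int_eq)
qed

text \<open>The errors of \<open>N\<close> and \<open>Q\<close> have opposite signs, so they add up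
  in the difference.\<close>

lemma dist_nearest_int_diff: "dist_nearest_int (real (N - Q) * \<alpha>) = A + B"
proof -
  have "real (N - Q) * \<alpha> - of_int (P - R) = of_int e * (A + B)"
    using sign Q_less by (auto simp: A_def B_def of_nat_diff algebra_simps)
  then have "\<bar>real (N - Q) * \<alpha> - of_int (P - R)\<bar> = A + B"
    using sign A_pos B_pos by (auto simp: abs_mult)
  then show ?thesis
    using AB_small by (metis dist_nearest_int_eq)
qed

text \<open>Along \<open>conj_index\<close> the first \<open>Q - 1\<close> arcs have length
  \<open>A + B\<close> and the others \<open>B\<close>; the singular arc, of length
  \<open>A\<close>, is the only one missed.\<close>

lemma conjugates_of_char_prefix:
  assumes "x \<in> {0..<1}"
  shows "\<forall>i<N. (cyc ^^ i) (rev (char_prefix \<alpha> N)) \<in> language \<alpha> x"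
    and "\<forall>i. i + 2 \<le> Q \<longrightarrow> arc_length (cylinder \<alpha> ((cyc ^^ i) (rev (char_prefix \<alpha> N))))
            = dist_nearest_int (real (N - Q) * \<alpha>)"
    and "\<forall>i. Q \<le> i + 1 \<and> i < N \<longrightarrow> arc_length (cylinder \<alpha> ((cyc ^^ i) (rev (char_prefix \<alpha> N))))
            = dist_nearest_int (real Q * \<alpha>)"
    and "\<exists>w. {u \<in> language \<alpha> x. length u = N}
              - {(cyc ^^ i) (rev (char_prefix \<alpha> N)) | i. i < N} = {w}
          \<and> arc_length (cylinder \<alpha> w) = dist_nearest_int (real N * \<alpha>)"
proof -
  have conj: "{(cyc ^^ i) (rev (char_prefix \<alpha> N)) | i. i < N} = W ` ({..N} - {singular_index})"
    unfolding image_conj_index[symmetric]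
    by (auto simp: conjugate_eq_W image_iff) (metis conjugate_eq_W)
  have "(cyc ^^ i) (rev (char_prefix \<alpha> N)) \<in> {u \<in> language \<alpha> x. length u = N}" if "i < N" for i
    unfolding language_length_N[OF assms] using that by (simp add: conjugate_eq_W conj_index_le)
  then show "\<forall>i<N. (cyc ^^ i) (rev (char_prefix \<alpha> N)) \<in> language \<alpha> x"
    by blast
  show "\<forall>i. i + 2 \<le> Q \<longrightarrow> arc_length (cylinder \<alpha> ((cyc ^^ i) (rev (char_prefix \<alpha> N))))
      = dist_nearest_int (real (N - Q) * \<alpha>)"
  proof (intro allI impI)
    fix i assume i: "i + 2 \<le> Q"
    then have "gap (conj_index i) = A + B"
      using Q_less sign by (auto simp: gap_def conj_index_def singular_index_def)
    with i show "arc_length (cylinder \<alpha> ((cyc ^^ i) (rev (char_prefix \<alpha> N))))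
        = dist_nearest_int (real (N - Q) * \<alpha>)"
      unfolding dist_nearest_int_diff
      using Q_less by (simp add: conjugate_eq_W arc_length_W conj_index_le)
  qed
  show "\<forall>i. Q \<le> i + 1 \<and> i < N \<longrightarrow> arc_length (cylinder \<alpha> ((cyc ^^ i) (rev (char_prefix \<alpha> N))))
      = dist_nearest_int (real Q * \<alpha>)"
  proof (intro allI impI)
    fix i assume i: "Q \<le> i + 1 \<and> i < N"
    then have "gap (conj_index i) = B"
      using Q_ge Q_less sign by (auto simp: gap_def conj_index_def singular_index_def)
    with i show "arc_length (cylinder \<alpha> ((cyc ^^ i) (rev (char_prefix \<alpha> N))))
        = dist_nearest_int (real Q * \<alpha>)"
      by (simp add: conjugate_eq_W arc_length_W conj_index_le dist_nearest_int_Q)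
  qed
  have sing: "singular_index \<le> N"
    by (simp add: singular_index_def)
  have "{u \<in> language \<alpha> x. length u = N} - {(cyc ^^ i) (rev (char_prefix \<alpha> N)) | i. i < N}
      = {W singular_index}"
    unfolding conj language_length_N[OF assms] using sing by (auto simp: W_inject)
  moreover have "arc_length (cylinder \<alpha> (W singular_index)) = dist_nearest_int (real N * \<alpha>)"
    by (simp add: arc_length_W[OF sing] dist_nearest_int_N gap_def)
  ultimately show "\<exists>w. {u \<in> language \<alpha> x. length u = N}
      - {(cyc ^^ i) (rev (char_prefix \<alpha> N)) | i. i < N} = {w}
      \<and> arc_length (cylinder \<alpha> w) = dist_nearest_int (real N * \<alpha>)"
    by blast
qed

end

section \<open>Continued fraction of the slope\<close>

lemma cf_finite_nonneg: "0 \<le> cf_finite bs"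
  by (induction bs) auto

lemma cf_finite_le_1:
  assumes "\<forall>b\<in>set bs. 0 < b"
  shows "cf_finite bs \<le> 1"
proof (cases bs)
  case (Cons b cs)
  then have "1 \<le> real b + cf_finite cs"
    using assms cf_finite_nonneg[of cs] by (simp add: Suc_le_eq add_increasing2)
  then show ?thesis
    by (simp add: Cons)
qed simp

text \<open>One step of the Gauss map: removing the first partial quotient from the finite fractions
  commutes with the limit because \<open>\<alpha>\<close> is nonzero.\<close>

lemma has_cf_expansion_tail:
  assumes cf: "has_cf_expansion \<alpha> a" and irr: "\<alpha> \<notin> \<rat>"
  shows "has_cf_expansion (1 / \<alpha> - real (a 1)) (\<lambda>i. a (Suc i))"
    and "1 / \<alpha> - real (a 1) \<notin> \<rat>"
    and "0 < 1 / \<alpha> - real (a 1)" and "1 / \<alpha> - real (a 1) < 1"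
proof -
  define t where "t n = cf_finite (map (\<lambda>i. a (Suc i)) [1..<Suc n])" for n
  define \<beta> where "\<beta> = 1 / \<alpha> - real (a 1)"
  have pos: "\<forall>i\<ge>1. a i > 0" and lim: "(\<lambda>n. cf_finite (map a [1..<Suc n])) \<longlonglongrightarrow> \<alpha>"
    using cf by (auto simp: has_cf_expansion_def)
  have "\<alpha> \<noteq> 0"
    using irr by auto
  have list: "map a [1..<Suc (Suc n)] = a 1 # map (\<lambda>i. a (Suc i)) [1..<Suc n]" for n
    by (rule nth_equalityI) (auto simp: nth_Cons' simp del: upt_Suc)
  have t: "t n = 1 / cf_finite (map a [1..<Suc (Suc n)]) - real (a 1)" for n
    by (simp only: list cf_finite.simps t_def) simp
  have "(\<lambda>n. 1 / cf_finite (map a [1..<Suc (Suc n)]) - real (a 1)) \<longlonglongrightarrow> \<beta>"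
    unfolding \<beta>_def by (intro tendsto_intros LIMSEQ_Suc[OF lim] \<open>\<alpha> \<noteq> 0\<close>)
  then have t_lim: "t \<longlonglongrightarrow> \<beta>"
    by (simp only: t[symmetric])
  show "has_cf_expansion (1 / \<alpha> - real (a 1)) (\<lambda>i. a (Suc i))"
    using pos t_lim by (auto simp: has_cf_expansion_def t_def[abs_def] \<beta>_def)
  have "\<beta> \<notin> \<rat>"
  proof
    assume "\<beta> \<in> \<rat>"
    then have "1 / (\<beta> + real (a 1)) \<in> \<rat>"
      by (intro Rats_divide Rats_add) auto
    then show False
      using irr by (simp add: \<beta>_def)
  qed
  then show "1 / \<alpha> - real (a 1) \<notin> \<rat>"
    by (simp add: \<beta>_def)
  have "0 \<le> \<beta>"
    using t_lim by (rule LIMSEQ_le_const) (simp add: t_def cf_finite_nonneg)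
  moreover have "\<beta> \<le> 1"
  proof (rule LIMSEQ_le_const2[OF t_lim], intro exI allI impI)
    show "t n \<le> 1" for n
      unfolding t_def using pos by (intro cf_finite_le_1) auto
  qed
  \<comment> \<open>The limit yields weak bounds; irrationality makes them strict.\<close>
  moreover have "\<beta> \<noteq> 0" "\<beta> \<noteq> 1"
    using \<open>\<beta> \<notin> \<rat>\<close> by auto
  ultimately show "0 < 1 / \<alpha> - real (a 1)" "1 / \<alpha> - real (a 1) < 1"
    by (auto simp: \<beta>_def)
qed

text \<open>The complete quotients, inverted: \<open>cf_tail \<alpha> a k = [0; a\<^sub>k\<^sub>+\<^sub>1, a\<^sub>k\<^sub>+\<^sub>2, \<dots>]\<close>.\<close>

fun cf_tail :: "real \<Rightarrow> (nat \<Rightarrow> nat) \<Rightarrow> nat \<Rightarrow> real" where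
  "cf_tail \<alpha> a 0 = \<alpha>"
| "cf_tail \<alpha> a (Suc k) = 1 / cf_tail \<alpha> a k - real (a (Suc k))"

text \<open>Numerators of the convergents whose denominators are \<open>q a k\<close>.\<close>

fun cf_num :: "(nat \<Rightarrow> nat) \<Rightarrow> nat \<Rightarrow> int" where
  "cf_num a 0 = 0"
| "cf_num a (Suc 0) = 1"
| "cf_num a (Suc (Suc k)) = int (a (Suc (Suc k))) * cf_num a (Suc k) + cf_num a k"

lemma cf_det: "int (q a k) * cf_num a (Suc k) - cf_num a k * int (q a (Suc k)) = (- 1) ^ k"
  by (induction k) (simp_all add: algebra_simps)

section \<open>Convergents, intermediate convergents and their errors\<close>

locale cf_slope =
  fixes \<alpha> :: real and a :: "nat \<Rightarrow> nat"
  assumes slope_pos: "0 < \<alpha>" and slope_less: "\<alpha> < 1" and slope_irrational: "\<alpha> \<notin> \<rat>"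
    and expansion: "has_cf_expansion \<alpha> a" and a1_ge: "2 \<le> a 1"
begin

lemma a_pos: "1 \<le> i \<Longrightarrow> 0 < a i"
  using expansion by (auto simp: has_cf_expansion_def)

lemma cf_tail_props:
  "0 < cf_tail \<alpha> a k \<and> cf_tail \<alpha> a k < 1 \<and> cf_tail \<alpha> a k \<notin> \<rat>
    \<and> has_cf_expansion (cf_tail \<alpha> a k) (\<lambda>i. a (i + k))"
proof (induction k)
  case 0
  then show ?case
    using slope_pos slope_less slope_irrational expansion by simp
next
  case (Suc k)
  then have cf: "has_cf_expansion (cf_tail \<alpha> a k) (\<lambda>i. a (i + k))" and irr: "cf_tail \<alpha> a k \<notin> \<rat>"
    by auto
  show ?case
    using has_cf_expansion_tail[OF cf irr] by simp
qed

lemma cf_tail_pos: "0 < cf_tail \<alpha> a k" and cf_tail_less: "cf_tail \<alpha> a k < 1"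
  using cf_tail_props by auto

text \<open>The classical product formula for the absolute error of the \<open>k\<close>-th
  convergent, scaled by its denominator; \<open>cf_error\<close> establishes this.\<close>

definition tail_prod :: "nat \<Rightarrow> real" where
  "tail_prod k = (\<Prod>i\<le>k. cf_tail \<alpha> a i)"

lemma tail_prod_pos: "0 < tail_prod k"
  unfolding tail_prod_def by (intro prod_pos) (simp add: cf_tail_pos)

lemma tail_prod_le: "tail_prod k \<le> \<alpha>"
proof (induction k)
  case 0
  then show ?case by (simp add: tail_prod_def)
next
  case (Suc k)
  have "tail_prod (Suc k) = tail_prod k * cf_tail \<alpha> a (Suc k)"
    by (simp add: tail_prod_def)
  also have "\<dots> \<le> tail_prod k * 1"
    using cf_tail_less[of "Suc k"] tail_prod_pos[of k] by (intro mult_left_mono) auto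
  finally show ?case using Suc by simp
qed

text \<open>Expanding the last factor by the Gauss map cancels the factor before it. The result is
  the recursion of \<open>q\<close>, up to the alternating sign of the errors.\<close>

lemma tail_prod_Suc_Suc:
  "tail_prod (Suc (Suc k)) = tail_prod k - real (a (Suc (Suc k))) * tail_prod (Suc k)"
proof -
  have "tail_prod (Suc (Suc k)) = tail_prod (Suc k) * cf_tail \<alpha> a (Suc (Suc k))"
    by (simp add: tail_prod_def del: cf_tail.simps)
  also have "\<dots> = tail_prod (Suc k) / cf_tail \<alpha> a (Suc k) - real (a (Suc (Suc k))) * tail_prod (Suc k)"
    by (simp add: algebra_simps del: cf_tail.simps(2)) (simp add: algebra_simps)
  also have "tail_prod (Suc k) / cf_tail \<alpha> a (Suc k) = tail_prod k"
    using cf_tail_pos[of "Suc k"] by (simp add: tail_prod_def del: cf_tail.simps)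
  finally show ?thesis .
qed

lemma cf_error: "real (q a k) * \<alpha> - of_int (cf_num a k) = (- 1) ^ k * tail_prod k"
proof (induction k rule: induct_nat_012)
  case 0
  then show ?case by (simp add: tail_prod_def)
next
  case 1
  then show ?case using slope_pos by (simp add: tail_prod_def field_simps)
next
  case (ge2 k)
  have "real (q a (Suc (Suc k))) * \<alpha> - of_int (cf_num a (Suc (Suc k)))
      = real (a (Suc (Suc k))) * (real (q a (Suc k)) * \<alpha> - of_int (cf_num a (Suc k)))
        + (real (q a k) * \<alpha> - of_int (cf_num a k))"
    by (simp add: algebra_simps)
  also have "\<dots> = (- 1) ^ Suc (Suc k) * tail_prod (Suc (Suc k))"
    unfolding ge2 tail_prod_Suc_Suc by (simp add: algebra_simps)
  finally show ?case .
qed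

lemma slope_bounds: "real (a 1) * \<alpha> < 1" "1 < (real (a 1) + 1) * \<alpha>"
  using has_cf_expansion_tail(3,4)[OF expansion slope_irrational] slope_pos
  by (auto simp: field_simps)

lemma slope_less_half: "\<alpha> < 1 / 2"
proof -
  have "2 * \<alpha> \<le> real (a 1) * \<alpha>"
    using a1_ge slope_pos by (intro mult_right_mono) auto
  then show ?thesis
    using slope_bounds(1) by simp
qed

lemma q_pos: "0 < q a k"
  by (induction k rule: induct_nat_012) (use a_pos[of 1] in auto)

lemma q_Suc_ge_2: "2 \<le> q a (Suc k)"
proof (induction k)
  case 0
  then show ?case using a1_ge by simp
next
  case (Suc k)
  have "1 * q a (Suc k) \<le> a (Suc (Suc k)) * q a (Suc k)"
    using a_pos[of "Suc (Suc k)"] by (intro mult_right_mono) auto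
  then have "2 \<le> a (Suc (Suc k)) * q a (Suc k)"
    using Suc by linarith
  then show ?case by simp
qed

text \<open>The determinant reduces to \<open>cf_det\<close>, as adding a multiple of one lattice
  vector to the other does not change it. The errors are
  \<open>A = tail_prod r - l * tail_prod (Suc r)\<close> and
  \<open>B = tail_prod (Suc r)\<close>.\<close>

lemma farey_pair_intermediate:
  assumes "0 < l" "l \<le> a (Suc (Suc r))"
  shows "farey_pair \<alpha> (l * q a (Suc r) + q a r) (q a (Suc r))
    (int l * cf_num a (Suc r) + cf_num a r) (cf_num a (Suc r)) ((- 1) ^ r)"
proof -
  have N: "of_int ((- 1) ^ r) * (real (l * q a (Suc r) + q a r) * \<alpha>
      - of_int (int l * cf_num a (Suc r) + cf_num a r)) = tail_prod r - real l * tail_prod (Suc r)"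
  proof -
    have "real (l * q a (Suc r) + q a r) * \<alpha> - of_int (int l * cf_num a (Suc r) + cf_num a r)
      = real l * (real (q a (Suc r)) * \<alpha> - of_int (cf_num a (Suc r)))
        + (real (q a r) * \<alpha> - of_int (cf_num a r))"
      by (simp add: algebra_simps)
    also have "\<dots> = (- 1) ^ r * (tail_prod r - real l * tail_prod (Suc r))"
      unfolding cf_error by (simp add: algebra_simps)
    finally show ?thesis
      by simp
  qed
  have Q: "of_int ((- 1) ^ r) * (of_int (cf_num a (Suc r)) - real (q a (Suc r)) * \<alpha>) = tail_prod (Suc r)"
  proof -
    have "of_int (cf_num a (Suc r)) - real (q a (Suc r)) * \<alpha> = (- 1) ^ r * tail_prod (Suc r)"
      using cf_error[of "Suc r"] by simp
    then show ?thesis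
      by simp
  qed
  have l_le: "real l * tail_prod (Suc r) \<le> real (a (Suc (Suc r))) * tail_prod (Suc r)"
    and l_ge: "1 * tail_prod (Suc r) \<le> real l * tail_prod (Suc r)"
    using assms tail_prod_pos[of "Suc r"] by (intro mult_right_mono; simp)+
  show ?thesis
  proof (unfold_locales, unfold N Q)
    show "\<alpha> \<notin> \<rat>" "0 < \<alpha>" "\<alpha> < 1 / 2"
      by (fact slope_irrational slope_pos slope_less_half)+
    show "(- 1 :: int) ^ r = 1 \<or> (- 1 :: int) ^ r = - 1"
      by (cases "even r") auto
    show "2 \<le> q a (Suc r)"
      by (rule q_Suc_ge_2)
    have "1 * q a (Suc r) \<le> l * q a (Suc r)"
      using assms(1) by (intro mult_right_mono) auto
    then show "q a (Suc r) < l * q a (Suc r) + q a r"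
      using q_pos[of r] by linarith
    show "int (l * q a (Suc r) + q a r) * cf_num a (Suc r)
        - (int l * cf_num a (Suc r) + cf_num a r) * int (q a (Suc r)) = (- 1) ^ r"
      using cf_det[of a r] by (simp add: algebra_simps)
    \<comment> \<open>The extreme case \<open>l = a (Suc (Suc r))\<close> leaves
      \<open>tail_prod (Suc (Suc r))\<close>, which is positive.\<close>
    show "0 < tail_prod r - real l * tail_prod (Suc r)"
      using l_le tail_prod_pos[of "Suc (Suc r)"] tail_prod_Suc_Suc[of r] by linarith
    show "0 < tail_prod (Suc r)"
      by (rule tail_prod_pos)
    \<comment> \<open>Since \<open>1 \<le> l\<close>, the sum is at most \<open>tail_prod r\<close>,
      hence at most \<open>\<alpha>\<close>.\<close>
    show "tail_prod r - real l * tail_prod (Suc r) + tail_prod (Suc r) < 1 / 2"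
      using l_ge tail_prod_le[of r] slope_less_half by linarith
  qed
qed

section \<open>Standard words as prefixes of the characteristic word\<close>

lemma word_pow_append_eq_char_prefix:
  assumes "std a (Suc r) = char_prefix \<alpha> (q a (Suc r))" "std a r = char_prefix \<alpha> (q a r)"
    and "l \<le> a (Suc (Suc r))"
  shows "word_pow (std a (Suc r)) l @ std a r = char_prefix \<alpha> (l * q a (Suc r) + q a r)"
  using assms(3)
proof (induction l)
  case 0
  then show ?case by (simp add: word_pow_def assms(2))
next
  case (Suc l)
  interpret farey_pair \<alpha> "Suc l * q a (Suc r) + q a r" "q a (Suc r)"
    "int (Suc l) * cf_num a (Suc r) + cf_num a r" "cf_num a (Suc r)" "(- 1) ^ r"
    using Suc.prems by (intro farey_pair_intermediate) auto
  \<comment> \<open>One block is peeled off on the left, to match the period \<open>Q\<close> in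
    \<open>char_prefix_split\<close>.\<close>
  have "word_pow (std a (Suc r)) (Suc l) @ std a r
      = std a (Suc r) @ (word_pow (std a (Suc r)) l @ std a r)"
    by (simp add: word_pow_def)
  also have "\<dots> = char_prefix \<alpha> (q a (Suc r)) @ char_prefix \<alpha> (l * q a (Suc r) + q a r)"
    using Suc by (simp add: assms(1))
  also have "\<dots> = char_prefix \<alpha> (Suc l * q a (Suc r) + q a r)"
    by (subst char_prefix_split) (simp add: add_ac)
  finally show ?case .
qed

lemma beatty_small: "0 \<le> h \<Longrightarrow> h \<le> int (a 1) \<Longrightarrow> beatty \<alpha> h = 0"
proof -
  assume h: "0 \<le> h" "h \<le> int (a 1)"
  have "real_of_int h * \<alpha> \<le> real_of_int (int (a 1)) * \<alpha>"
    by (intro mult_right_mono) (use h slope_pos in \<open>simp_all only: of_int_le_iff less_imp_le\<close>)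
  then have "real_of_int h * \<alpha> < 1"
    using slope_bounds(1) by simp
  then show "beatty \<alpha> h = 0"
    unfolding beatty_def using h(1) slope_pos by (intro floor_unique) auto
qed

lemma beatty_a1_Suc: "beatty \<alpha> (int (a 1) + 1) = 1"
  unfolding beatty_def using slope_bounds slope_less by (intro floor_unique) (auto simp: algebra_simps)

text \<open>Two consecutive ranks are carried along because the recursion has order two. At the
  base, the floors of \<open>h \<alpha>\<close> vanish up to \<open>h = a 1\<close> and then jump to
  1, which produces the single letter 1 ending \<open>std a 1\<close>.\<close>

lemma std_eq_char_prefix: "std a r = char_prefix \<alpha> (q a r) \<and> std a (Suc r) = char_prefix \<alpha> (q a (Suc r))"
proof (induction r)
  case 0
  have "std a 0 = char_prefix \<alpha> (q a 0)"
    using beatty_small[of 1] beatty_small[of 2] a1_ge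
    by (simp add: char_prefix_def mech_letter_def)
  moreover have "std a (Suc 0) = char_prefix \<alpha> (q a (Suc 0))"
  proof (rule nth_equalityI)
    show "length (std a (Suc 0)) = length (char_prefix \<alpha> (q a (Suc 0)))"
      using a1_ge by simp
    fix m assume "m < length (std a (Suc 0))"
    then have m: "m < a 1" using a1_ge by simp
    show "std a (Suc 0) ! m = char_prefix \<alpha> (q a (Suc 0)) ! m"
    proof (cases "m = a 1 - 1")
      case True
      then have "int m + 1 = int (a 1)"
        using a1_ge by simp
      then show ?thesis
        using True m beatty_small[of "int (a 1)"] beatty_a1_Suc
        by (simp add: char_prefix_def mech_letter_def nth_append add.commute)
    next
      case False
      then show ?thesis
        using m beatty_small[of "int m + 1"] beatty_small[of "int m + 2"]
        by (simp add: char_prefix_def mech_letter_def nth_append add_ac)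
    qed
  qed
  ultimately show ?case ..
next
  case (Suc r)
  then show ?case
    using word_pow_append_eq_char_prefix[of r "a (Suc (Suc r))"] by simp
qed

lemma std_inter_eq_char_prefix:
  assumes "l \<le> a (Suc (Suc r))"
  shows "std_inter a (Suc (Suc r)) l = char_prefix \<alpha> (q_inter a (Suc (Suc r)) l)"
  using word_pow_append_eq_char_prefix[OF _ _ assms] std_eq_char_prefix[of r]
  by (simp add: std_inter_def q_inter_def)

end

section \<open>The conjugates of the reversed standard words\<close>

theorem theorem4p3:
  fixes \<alpha> x :: real and a :: "nat \<Rightarrow> nat" and k l n :: nat
  assumes "0 < \<alpha>" and "\<alpha> < 1" and "\<alpha> \<notin> \<rat>"
    and "has_cf_expansion \<alpha> a" and "a 1 \<ge> 2"
    and "x \<in> {0..<1}"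
    and "k \<ge> 2" and "0 < l" and "l \<le> a k" and "n = q_inter a k l"
  shows "(\<forall>i<n. (cyc ^^ i) (rev (std_inter a k l)) \<in> language \<alpha> x)
    \<and> (\<forall>i. i + 2 \<le> q a (k - 1) \<longrightarrow>
          arc_length (cylinder \<alpha> ((cyc ^^ i) (rev (std_inter a k l))))
            = dist_nearest_int (real (q_inter a k (l - 1)) * \<alpha>))
    \<and> (\<forall>i. q a (k - 1) \<le> i + 1 \<and> i < n \<longrightarrow>
          arc_length (cylinder \<alpha> ((cyc ^^ i) (rev (std_inter a k l))))
            = dist_nearest_int (real (q a (k - 1)) * \<alpha>))
    \<and> (\<exists>w. {u \<in> language \<alpha> x. length u = n}
              - {(cyc ^^ i) (rev (std_inter a k l)) | i. i < n} = {w}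
          \<and> arc_length (cylinder \<alpha> w) = dist_nearest_int (real (q_inter a k l) * \<alpha>))"
proof -
  obtain r where k: "k = Suc (Suc r)"
    using assms(7) by (metis add_2_eq_Suc le_Suc_ex)
  interpret cf_slope \<alpha> a
    using assms by unfold_locales auto
  have n: "n = l * q a (Suc r) + q a r"
    using assms(10) by (simp add: q_inter_def k)
  interpret farey_pair \<alpha> n "q a (Suc r)" "int l * cf_num a (Suc r) + cf_num a r"
    "cf_num a (Suc r)" "(- 1) ^ r"
    unfolding n using assms(8,9) by (intro farey_pair_intermediate) (auto simp: k)
  have word: "std_inter a k l = char_prefix \<alpha> n"
    using assms(9,10) std_inter_eq_char_prefix by (simp add: k)
  \<comment> \<open>This identifies the index shift \<open>N - Q\<close> of the long arcs with
    \<open>q_{k,l-1}\<close>.\<close>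
  have pred: "q_inter a k (l - 1) = n - q a (Suc r)"
    using assms(8) by (cases l) (simp_all add: n k q_inter_def)
  have Q: "q a (k - 1) = q a (Suc r)"
    by (simp add: k)
  show ?thesis
    unfolding word pred Q assms(10)[symmetric]
    by (intro conjI) (fact conjugates_of_char_prefix[OF assms(6)])+
qed

end
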